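(* Let $n\ge 5$ be an integer and let $H_n$ be the weighted tree with $n$ vertices $E_0,E_1,\dots,E_{n-1}$, where $E_0$ has weight $3$, all other vertices have weight $2$, and the edges are those of the chain $E_1 - E_2 - E_3 - \cdots - E_{n-1}$ together with one edge joining $E_0$ and $E_3$. Then the number of elements of the triple root system $R(H_n)$ is $(n^3-n)/3$.
   Context: For a finite weighted tree $\Gamma$ with vertices $V_i$ of weights $w_i$, the intersection form on $\bigoplus_i\mathbb{Z}V_i$ is the symmetric bilinear form with $(V_i\cdot V_i)=-w_i$ and, for $i\neq j$, $(V_i\cdot V_j)=1$ if $V_i$ and $V_j$ are joined by an edge and $0$ otherwise. A non-zero element $\sum m_iV_i$ is a positive (resp. negative) divisor if all $m_i\ge 0$ (resp. all $m_i\le 0$). The triple root system $R(\Gamma)$ is the set of all positive and negative divisors $Y$ with $(Y\cdot Y)=-2$ or $(Y\cdot Y)=-3$. *)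

theory Defs
  imports Complex_Main "HOL-Library.Poly_Mapping"
begin

record 'a weighted_graph =
  verts :: "'a set"
  edges :: "'a set set"
  weight :: "'a \<Rightarrow> int"

definition adjacent :: "('a, 'b) weighted_graph_scheme \<Rightarrow> 'a \<Rightarrow> 'a \<Rightarrow> bool" where
  "adjacent \<Gamma> u v \<longleftrightarrow> u \<noteq> v \<and> {u, v} \<in> edges \<Gamma>"

definition is_cycle :: "('a, 'b) weighted_graph_scheme \<Rightarrow> 'a list \<Rightarrow> bool" where
  "is_cycle \<Gamma> c \<longleftrightarrow> 3 \<le> length c \<and> distinct c \<and>
     (\<forall>i<length c. adjacent \<Gamma> (c ! i) (c ! (Suc i mod length c)))"

definition weighted_tree :: "('a, 'b) weighted_graph_scheme \<Rightarrow> bool" where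
  "weighted_tree \<Gamma> \<longleftrightarrow>
     finite (verts \<Gamma>) \<and> verts \<Gamma> \<noteq> {} \<and>
     (\<forall>e\<in>edges \<Gamma>. e \<subseteq> verts \<Gamma> \<and> card e = 2) \<and>
     (\<forall>u\<in>verts \<Gamma>. \<forall>v\<in>verts \<Gamma>. (adjacent \<Gamma>)\<^sup>*\<^sup>* u v) \<and>
     (\<nexists>c. is_cycle \<Gamma> c)"

text \<open>The free abelian group on the vertices, as finitely supported integer functions
  whose support consists of vertices.\<close>

definition divisor_group :: "('a, 'b) weighted_graph_scheme \<Rightarrow> ('a \<Rightarrow>\<^sub>0 int) set" where
  "divisor_group \<Gamma> = {Y. Poly_Mapping.keys Y \<subseteq> verts \<Gamma>}"

definition vertex_pairing :: "('a, 'b) weighted_graph_scheme \<Rightarrow> 'a \<Rightarrow> 'a \<Rightarrow> int" where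
  "vertex_pairing \<Gamma> u v =
     (if u = v then - weight \<Gamma> u else if adjacent \<Gamma> u v then 1 else 0)"

text \<open>The bilinear extension of the vertex pairing, for graphs with finitely many vertices.\<close>

definition intersection_form ::
  "('a, 'b) weighted_graph_scheme \<Rightarrow> ('a \<Rightarrow>\<^sub>0 int) \<Rightarrow> ('a \<Rightarrow>\<^sub>0 int) \<Rightarrow> int" where
  "intersection_form \<Gamma> Y Z =
     (\<Sum>u\<in>verts \<Gamma>. \<Sum>v\<in>verts \<Gamma>.
        Poly_Mapping.lookup Y u * Poly_Mapping.lookup Z v * vertex_pairing \<Gamma> u v)"

definition positive_divisor :: "('a, 'b) weighted_graph_scheme \<Rightarrow> ('a \<Rightarrow>\<^sub>0 int) \<Rightarrow> bool" where
  "positive_divisor \<Gamma> Y \<longleftrightarrow>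
     Y \<in> divisor_group \<Gamma> \<and> Y \<noteq> 0 \<and> (\<forall>v\<in>verts \<Gamma>. 0 \<le> Poly_Mapping.lookup Y v)"

definition negative_divisor :: "('a, 'b) weighted_graph_scheme \<Rightarrow> ('a \<Rightarrow>\<^sub>0 int) \<Rightarrow> bool" where
  "negative_divisor \<Gamma> Y \<longleftrightarrow>
     Y \<in> divisor_group \<Gamma> \<and> Y \<noteq> 0 \<and> (\<forall>v\<in>verts \<Gamma>. Poly_Mapping.lookup Y v \<le> 0)"

definition triple_root_system :: "('a, 'b) weighted_graph_scheme \<Rightarrow> ('a \<Rightarrow>\<^sub>0 int) set" where
  "triple_root_system \<Gamma> =
     {Y. (positive_divisor \<Gamma> Y \<or> negative_divisor \<Gamma> Y) \<and>
         (intersection_form \<Gamma> Y Y = -2 \<or> intersection_form \<Gamma> Y Y = -3)}"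

text \<open>The vertex \<open>E\<^sub>i\<close> is represented by the number \<open>i\<close>. The graph is a tree only if
  \<open>n \<ge> 4\<close>, so that the vertex 3 exists.\<close>

definition H_graph :: "nat \<Rightarrow> nat weighted_graph" where
  "H_graph n =
     \<lparr>verts = {0..<n},
      edges = {{i, Suc i} | i. 1 \<le> i \<and> Suc i < n} \<union> {{0, 3}},
      weight = (\<lambda>i. if i = 0 then 3 else 2)\<rparr>"

lemma intersection_form_vertices:
  assumes "finite (verts \<Gamma>)" "u \<in> verts \<Gamma>" "v \<in> verts \<Gamma>"
  shows "intersection_form \<Gamma> (Poly_Mapping.single u 1) (Poly_Mapping.single v 1) =
    vertex_pairing \<Gamma> u v"
proof -
  have "intersection_form \<Gamma> (Poly_Mapping.single u 1) (Poly_Mapping.single v 1) =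
    (\<Sum>x\<in>verts \<Gamma>. if x = u then (\<Sum>y\<in>verts \<Gamma>. if y = v then vertex_pairing \<Gamma> x y else 0) else 0)"
    unfolding intersection_form_def
    by (intro sum.cong) (auto simp: lookup_single when_def intro!: sum.cong sum.neutral)
  then show ?thesis
    using assms by simp
qed

lemma adjacent_H_graph:
  "adjacent (H_graph n) u v \<longleftrightarrow>
     (1 \<le> u \<and> v = Suc u \<and> v < n) \<or> (1 \<le> v \<and> u = Suc v \<and> u < n) \<or>
     (u = 0 \<and> v = 3) \<or> (u = 3 \<and> v = 0)"
  unfolding adjacent_def H_graph_def by (auto simp: doubleton_eq_iff)

lemma no_cycle_H_graph: "\<not> is_cycle (H_graph n) c"
proof
  assume c: "is_cycle (H_graph n) c"
  define l where "l = length c"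
  have l: "3 \<le> l" and dist: "distinct c"
    and adj: "\<And>i. i < l \<Longrightarrow> adjacent (H_graph n) (c ! i) (c ! (Suc i mod l))"
    using c by (auto simp: is_cycle_def l_def)
  have sym: "adjacent (H_graph n) v u" if "adjacent (H_graph n) u v" for u v
    using that by (auto simp: adjacent_def insert_commute)
  have nbrs: "\<exists>a b. a \<in> set c \<and> b \<in> set c \<and> a \<noteq> b \<and>
      adjacent (H_graph n) x a \<and> adjacent (H_graph n) x b" if x: "x \<in> set c" for x
  proof -
    obtain i where i: "i < l" "x = c ! i"
      using x by (auto simp: in_set_conv_nth l_def)
    define j where "j = (if i = 0 then l - 1 else i - 1)"
    define k where "k = (if Suc i = l then 0 else Suc i)"
    have jl: "j < l" and kl: "k < l" and jk: "j \<noteq> k"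
      using i l by (auto simp: j_def k_def split: if_splits)
    have "Suc j mod l = i" "Suc i mod l = k"
      using i l by (auto simp: j_def k_def)
    then have "adjacent (H_graph n) (c ! j) x" "adjacent (H_graph n) x (c ! k)"
      using adj[OF jl] adj[OF i(1)] i(2) by auto
    moreover have "c ! j \<noteq> c ! k"
      using dist jl kl jk by (simp add: nth_eq_iff_index_eq l_def)
    ultimately show ?thesis
      using jl kl sym l_def nth_mem by metis
  qed
  have zero: "0 \<notin> set c"
    using nbrs[of 0] by (auto simp: adjacent_H_graph)
  define m where "m = Max (set c)"
  have "c \<noteq> []"
    using l by (auto simp: l_def)
  then have m: "m \<in> set c" "\<And>x. x \<in> set c \<Longrightarrow> x \<le> m"
    by (auto simp: m_def)
  obtain a b where "a \<in> set c" "b \<in> set c" "a \<noteq> b"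
    "adjacent (H_graph n) m a" "adjacent (H_graph n) m b"
    using nbrs[OF m(1)] by blast
  then show False
    using m(2)[of a] m(2)[of b] zero by (auto simp: adjacent_H_graph)
qed

lemma weighted_tree_H_graph:
  assumes "4 \<le> n"
  shows "weighted_tree (H_graph n)"
proof -
  let ?R = "(adjacent (H_graph n))\<^sup>*\<^sup>*"
  have sym: "?R v u" if "?R u v" for u v
    using that
    by (rule sympD[OF symp_rtranclp, rotated])
       (auto simp: symp_def adjacent_def insert_commute)
  have one: "?R 1 (Suc i)" if "Suc i < n" for i
    using that
  proof (induction i)
    case (Suc i)
    then have "?R 1 (Suc i)"
      by simp
    moreover have "adjacent (H_graph n) (Suc i) (Suc (Suc i))"
      using Suc.prems by (simp add: adjacent_H_graph)
    ultimately show ?case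
      by (rule rtranclp.rtrancl_into_rtrancl)
  qed simp
  have "?R 1 3"
    using one[of 2] assms by simp
  moreover have "adjacent (H_graph n) 3 0"
    by (simp add: adjacent_H_graph)
  ultimately have "?R 1 0"
    by (rule rtranclp.rtrancl_into_rtrancl)
  then have all: "?R 1 v" if "v < n" for v
    using one that by (cases v) auto
  have "?R u v" if "u < n" "v < n" for u v
    using sym[OF all[OF that(1)]] all[OF that(2)] by (rule rtranclp_trans)
  then show ?thesis
    using assms no_cycle_H_graph by (auto simp: weighted_tree_def H_graph_def)
qed

end

theory Submission imports Defs begin

text \<open>Embed the chain \<open>E\<^sub>1 - \<dots> - E\<^sub>n\<^sub>-\<^sub>1\<close> as the root lattice \<open>A\<^sub>n\<^sub>-\<^sub>1\<close> in \<open>\<int>\<^sup>n\<close>, the vertex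
  \<open>E\<^sub>i\<close> being \<open>e\<^sub>i\<^sub>-\<^sub>1 - e\<^sub>i\<close>, and send \<open>E\<^sub>0\<close> to \<open>-(e\<^sub>0 + e\<^sub>1 + e\<^sub>2)\<close>. This identifies minus the
  intersection form with the Euclidean form on the lattice of integer vectors whose coordinate
  sum is divisible by 3. Its vectors of norm 2 and 3 are the \<open>e\<^sub>p - e\<^sub>q\<close> and the
  \<open>\<plusminus>(e\<^sub>p + e\<^sub>q + e\<^sub>r)\<close>; there are \<open>n (n - 1) + 2 (n choose 3)\<close> of them, and each turns out to be
  a positive or a negative divisor.\<close>

section \<open>Embedding of the divisor group into the Euclidean lattice\<close>

text \<open>The coefficient of \<open>e_j\<close> in the image of the divisor with multiplicities
  \<open>a\<close>. The case \<open>j = 0\<close> is separate because index 0 names the branch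
  vertex, not a chain vertex preceding \<open>E_1\<close>.\<close>

definition coord :: "(nat \<Rightarrow> int) \<Rightarrow> nat \<Rightarrow> int" where
  "coord a j = a (Suc j) - (if j = 0 then 0 else a j) - (if j < 3 then a 0 else 0)"

text \<open>Partial sums telescope along the chain, so they recover \<open>a i\<close> once
  \<open>a 0\<close> is known; this is what makes the embedding invertible.\<close>

lemma sum_coord:
  "(\<Sum>j<i. coord a j) = (if i = 0 then 0 else a i) - a 0 * int (min i 3)"
proof (induction i)
  case (Suc i)
  then show ?case
    by (cases "i < 3"; cases "i = 0") (simp_all add: coord_def min_absorb1 min_absorb2 algebra_simps)
qed simp

lemma weight_H_graph: "weight (H_graph n) u = (if u = 0 then 3 else 2)"
  by (simp add: H_graph_def)

lemma vertex_pairing_H_graph: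
  assumes "u < n" "v < n"
  shows "vertex_pairing (H_graph n) u v =
    (if u = v then if u = 0 then - 3 else - 2
     else if 1 \<le> u \<and> v = Suc u \<or> 1 \<le> v \<and> u = Suc v \<or> u = 0 \<and> v = 3 \<or> u = 3 \<and> v = 0
     then 1 else 0)"
  using assms by (auto simp: vertex_pairing_def adjacent_H_graph weight_H_graph)

lemma vertex_pairing_H_graph_Suc:
  assumes "u < n" "v < n"
  shows "vertex_pairing (H_graph (Suc n)) u v = vertex_pairing (H_graph n) u v"
  using assms by (simp add: vertex_pairing_H_graph)

text \<open>Induction on the length of the chain. As \<open>a n\<close> is arbitrary here, the last
  coordinate is \<open>- a (n - 1)\<close> and its square stands apart from the sum. A new end
  vertex \<open>E_n\<close> replaces \<open>(a (n - 1))\<^sup>2\<close> by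
  \<open>(a n - a (n - 1))\<^sup>2 + (a n)\<^sup>2\<close>.\<close>

lemma pairing_sum_eq_coord:
  assumes "4 \<le> n"
  shows "(\<Sum>u<n. \<Sum>v<n. a u * a v * vertex_pairing (H_graph n) u v) =
    - ((\<Sum>j<n - 1. (coord a j)\<^sup>2) + (a (n - 1))\<^sup>2)"
  using assms
proof (induction n rule: dec_induct)
  case base
  have four: "{..<4::nat} = {0, 1, 2, 3}" and three: "{..<4 - 1::nat} = {0, 1, 2}"
    by auto
  show ?case
    unfolding four three
    by (simp add: vertex_pairing_H_graph coord_def power2_eq_square algebra_simps
        flip: numeral_2_eq_2)
next
  case (step n)
  obtain m where m: "n = Suc m" "3 \<le> m"
    using step.hyps by (cases n) auto
  let ?w = "vertex_pairing (H_graph (Suc n))"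
  \<comment> \<open>Among the earlier vertices \<open>E_n\<close> meets only \<open>E_m\<close>; it
    does not meet \<open>E_0\<close>, because \<open>n\<close> is at least 4.\<close>
  have col: "(\<Sum>u<n. a u * a n * ?w u n) = a m * a n"
  proof -
    have "(\<Sum>u<n. a u * a n * ?w u n) = (\<Sum>u<n. if u = m then a m * a n else 0)"
      using m by (intro sum.cong) (auto simp: vertex_pairing_H_graph)
    then show ?thesis
      using m by simp
  qed
  have row: "(\<Sum>v<n. a n * a v * ?w n v) = a m * a n"
  proof -
    have "(\<Sum>v<n. a n * a v * ?w n v) = (\<Sum>u<n. if u = m then a m * a n else 0)"
      using m by (intro sum.cong) (auto simp: vertex_pairing_H_graph)
    then show ?thesis
      using m by simp
  qed
  have diag: "?w n n = - 2"
    using m by (simp add: vertex_pairing_H_graph)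
  have "(\<Sum>u<Suc n. \<Sum>v<Suc n. a u * a v * ?w u v) =
      (\<Sum>u<n. \<Sum>v<n. a u * a v * ?w u v) + 2 * (a m * a n) - 2 * (a n)\<^sup>2"
    using col row diag by (simp add: sum.distrib power2_eq_square)
  also have "(\<Sum>u<n. \<Sum>v<n. a u * a v * ?w u v) =
      (\<Sum>u<n. \<Sum>v<n. a u * a v * vertex_pairing (H_graph n) u v)"
    by (intro sum.cong) (auto simp: vertex_pairing_H_graph_Suc)
  also have "\<dots> = - ((\<Sum>j<m. (coord a j)\<^sup>2) + (a m)\<^sup>2)"
    using step.IH m by simp
  finally show ?case
    using m by (simp add: coord_def power2_eq_square algebra_simps)
qed

lemma intersection_form_H_graph:
  assumes "4 \<le> n" "Y \<in> divisor_group (H_graph n)"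
  shows "intersection_form (H_graph n) Y Y = - (\<Sum>j<n. (coord (Poly_Mapping.lookup Y) j)\<^sup>2)"
proof -
  obtain m where m: "n = Suc m" "3 \<le> m"
    using assms by (cases n) auto
  \<comment> \<open>This turns the separate last square into that of \<open>coord\<close> at
    \<open>n - 1\<close>.\<close>
  have "Poly_Mapping.lookup Y n = 0"
    using assms(2) by (auto simp: divisor_group_def H_graph_def in_keys_iff)
  moreover have "verts (H_graph n) = {..<n}"
    by (auto simp: H_graph_def)
  ultimately show ?thesis
    using pairing_sum_eq_coord[OF assms(1), of "Poly_Mapping.lookup Y"] m
    by (simp add: intersection_form_def coord_def)
qed

section \<open>Inverse of the embedding\<close>

text \<open>Solves \<open>sum_coord\<close> for the multiplicities: the total of the coordinates is
  \<open>-3 * a 0\<close>, and each further \<open>a i\<close> is a partial sum corrected by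
  \<open>a 0\<close>. The division is exact precisely on the lattice.\<close>

definition divisor_of :: "nat \<Rightarrow> (nat \<Rightarrow> int) \<Rightarrow> (nat \<Rightarrow>\<^sub>0 int)" where
  "divisor_of n z = Abs_poly_mapping (\<lambda>i.
     if i = 0 then - ((\<Sum>j<n. z j) div 3)
     else if i < n then (\<Sum>j<i. z j) - (\<Sum>j<n. z j) div 3 * int (min i 3)
     else 0)"

lemma lookup_divisor_of:
  assumes "0 < n"
  shows "Poly_Mapping.lookup (divisor_of n z) i =
    (if i = 0 then - ((\<Sum>j<n. z j) div 3)
     else if i < n then (\<Sum>j<i. z j) - (\<Sum>j<n. z j) div 3 * int (min i 3)
     else 0)"
proof -
  let ?f = "\<lambda>i. if i = 0 then - ((\<Sum>j<n. z j) div 3)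
     else if i < n then (\<Sum>j<i. z j) - (\<Sum>j<n. z j) div 3 * int (min i 3)
     else 0"
  have "{i. ?f i \<noteq> 0} \<subseteq> {..<n}"
    using assms by auto
  then have "finite {i. ?f i \<noteq> 0}"
    by (rule finite_subset) simp
  then show ?thesis
    unfolding divisor_of_def by (subst lookup_Abs_poly_mapping) simp_all
qed

lemma divisor_of_in_divisor_group:
  assumes "0 < n"
  shows "divisor_of n z \<in> divisor_group (H_graph n)"
  using assms
  by (auto simp: divisor_group_def H_graph_def in_keys_iff lookup_divisor_of split: if_splits)

lemma coord_divisor_of:
  assumes "3 \<le> n" "3 dvd (\<Sum>j<n. z j)" "j < n"
  shows "coord (Poly_Mapping.lookup (divisor_of n z)) j = z j"
proof -
  obtain c where c: "(\<Sum>j<n. z j) = 3 * c"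
    using assms(2) by (auto simp: dvd_def)
  \<comment> \<open>The formula extends to \<open>i = n\<close>, where both sides vanish since the
    total is \<open>3 * c\<close>; the last coordinate, \<open>j = n - 1\<close>, relies on that
    value.\<close>
  have lk: "Poly_Mapping.lookup (divisor_of n z) i = (\<Sum>j<i. z j) - c * int (min i 3)"
    if "0 < i" "i \<le> n" for i
    using that assms(1) c by (cases "i = n") (simp_all add: lookup_divisor_of)
  have low: "(if j = 0 then 0 else Poly_Mapping.lookup (divisor_of n z) j) = (\<Sum>i<j. z i) - c * int (min j 3)"
    using lk assms(3) by simp
  have "Poly_Mapping.lookup (divisor_of n z) (Suc j) = (\<Sum>i<j. z i) + z j - c * int (min (Suc j) 3)"
    using lk[of "Suc j"] assms(3) by simp
  moreover have "Poly_Mapping.lookup (divisor_of n z) 0 = - c"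
    using assms(1) c by (simp add: lookup_divisor_of)
  ultimately show ?thesis
    unfolding coord_def low
    by (cases "j < 3") (simp_all add: min_absorb1 min_absorb2 algebra_simps)
qed

text \<open>Shows that the image lies in the lattice of vectors with coordinate sum divisible by
  3.\<close>

lemma sum_coord_divisor:
  assumes "3 \<le> n" "Y \<in> divisor_group (H_graph n)"
  shows "(\<Sum>j<n. coord (Poly_Mapping.lookup Y) j) = - 3 * Poly_Mapping.lookup Y 0"
proof -
  have "Poly_Mapping.lookup Y n = 0"
    using assms(2) by (auto simp: divisor_group_def H_graph_def in_keys_iff)
  then show ?thesis
    using assms by (simp add: sum_coord)
qed

lemma divisor_of_coord:
  assumes "3 \<le> n" "Y \<in> divisor_group (H_graph n)" "\<And>j. j < n \<Longrightarrow> z j = coord (Poly_Mapping.lookup Y) j"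
  shows "divisor_of n z = Y"
proof (rule poly_mapping_eqI)
  fix i
  have out: "Poly_Mapping.lookup Y i = 0" if "n \<le> i"
    using that assms(2) by (auto simp: divisor_group_def H_graph_def in_keys_iff)
  have part: "(\<Sum>j<i. z j) = (\<Sum>j<i. coord (Poly_Mapping.lookup Y) j)" if "i \<le> n" for i
    using that assms(3) by (intro sum.cong) auto
  have tot: "(\<Sum>j<n. z j) = - 3 * Poly_Mapping.lookup Y 0"
    using part[of n] sum_coord_divisor[OF assms(1,2)] by simp
  have "(\<Sum>j<n. z j) div 3 = - Poly_Mapping.lookup Y 0"
    unfolding tot by simp
  then show "Poly_Mapping.lookup (divisor_of n z) i = Poly_Mapping.lookup Y i"
    using assms(1) out part[of i] by (auto simp: lookup_divisor_of sum_coord)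
qed

section \<open>Short lattice vectors and their number\<close>

text \<open>Vectors of norm 2 or 3 have entries in {-1, 0, 1}, so the sets of positions of 1 and of
  -1 determine them.\<close>

definition sign_vector :: "nat set \<times> nat set \<Rightarrow> nat \<Rightarrow> int" where
  "sign_vector = (\<lambda>(P, N) j. of_bool (j \<in> P) - of_bool (j \<in> N))"

definition root_supports :: "nat \<Rightarrow> (nat set \<times> nat set) set" where
  "root_supports n =
     (\<lambda>(p, q). ({p}, {q})) ` ({..<n} \<times> {..<n} - Id)
     \<union> (\<lambda>P. (P, {})) ` {P. P \<subseteq> {..<n} \<and> card P = 3}
     \<union> (\<lambda>N. ({}, N)) ` {N. N \<subseteq> {..<n} \<and> card N = 3}"

text \<open>The defining union suits counting; this form matches what norm and coordinate sum say
  about a vector.\<close>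

lemma root_supports_iff:
  "(P, N) \<in> root_supports n \<longleftrightarrow>
     P \<subseteq> {..<n} \<and> N \<subseteq> {..<n} \<and> P \<inter> N = {} \<and>
     (card P = 1 \<and> card N = 1 \<or> card P = 3 \<and> card N = 0 \<or> card P = 0 \<and> card N = 3)"
proof -
  \<comment> \<open>An infinite set also has \<open>card\<close> 0; boundedness rules it
    out.\<close>
  have fin: "card A = 0 \<longleftrightarrow> A = {}" if "A \<subseteq> {..<n}" for A
    using that finite_subset by fastforce
  have sing: "(P, N) \<in> (\<lambda>(p, q). ({p}, {q})) ` ({..<n} \<times> {..<n} - Id) \<longleftrightarrow>
      P \<subseteq> {..<n} \<and> N \<subseteq> {..<n} \<and> P \<inter> N = {} \<and> card P = 1 \<and> card N = 1"
    (is "?L \<longleftrightarrow> ?R")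
  proof
    assume ?R
    then obtain p q where "P = {p}" "N = {q}"
      by (metis card_1_singletonE)
    with \<open>?R\<close> show ?L
      by auto
  qed auto
  show ?thesis
    unfolding root_supports_def Un_iff sing using fin by auto
qed

lemma choose_three: "real (n choose 3) = real n * (real n - 1) * (real n - 2) / 6"
proof (induction n)
  case (Suc n)
  have "real (n choose 2) = real n * (real n - 1) / 2"
    by (induction n) (simp_all add: numeral_2_eq_2 field_simps)
  then show ?case
    using Suc by (simp add: numeral_3_eq_3 numeral_2_eq_2 field_simps)
qed simp

text \<open>The three families are disjoint, and \<open>n (n - 1) + n (n - 1) (n - 2) / 3\<close>
  equals \<open>n (n - 1) (n + 1) / 3\<close>.\<close>

lemma card_root_supports:
  "finite (root_supports n) \<and> real (card (root_supports n)) = (real n ^ 3 - real n) / 3"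
proof -
  let ?T = "{P. P \<subseteq> {..<n} \<and> card P = 3}"
  let ?A = "(\<lambda>(p, q). ({p}, {q})) ` ({..<n} \<times> {..<n} - Id)"
  let ?B = "(\<lambda>P. (P, {} :: nat set)) ` ?T" and ?C = "(\<lambda>N. ({} :: nat set, N)) ` ?T"
  have fin: "finite ?A" "finite ?B" "finite ?C"
    by auto
  have A: "real (card ?A) = real n * real n - real n"
  proof -
    have "card ?A = card ({..<n} \<times> {..<n} - Id)"
      by (rule card_image) (auto simp: inj_on_def)
    moreover have "{..<n} \<times> {..<n} - Id = {..<n} \<times> {..<n} - (\<lambda>i. (i, i)) ` {..<n}"
      by auto
    moreover have "card ({..<n} \<times> {..<n} - (\<lambda>i. (i, i)) ` {..<n}) = n * n - n"
      by (subst card_Diff_subset) (auto simp: card_image inj_on_def)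
    ultimately have "card ?A = n * n - n"
      by metis
    then show ?thesis
      by (metis le_square of_nat_diff of_nat_mult)
  qed
  have B: "card ?B = n choose 3" and C: "card ?C = n choose 3"
    by (subst card_image; simp add: inj_on_def n_subsets)+
  have disj: "?A \<inter> ?B = {}" "(?A \<union> ?B) \<inter> ?C = {}"
    by auto
  have "card (root_supports n) = card ?A + card ?B + card ?C"
    unfolding root_supports_def using fin disj by (simp add: card_Un_disjoint)
  then have "real (card (root_supports n)) = (real n ^ 3 - real n) / 3"
    using A B C by (simp add: choose_three power3_eq_cube field_simps)
  moreover have "finite (root_supports n)"
    unfolding root_supports_def using fin by blast
  ultimately show ?thesis
    by blast
qed

lemma sum_sign_vector:
  assumes "finite A"
  shows "(\<Sum>j\<in>A. sign_vector (P, N) j) = int (card (A \<inter> P)) - int (card (A \<inter> N))"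
  using assms by (simp add: sign_vector_def sum_subtractf)

lemma sum_sign_vector_squared:
  assumes "finite A" "P \<inter> N = {}"
  shows "(\<Sum>j\<in>A. (sign_vector (P, N) j)\<^sup>2) = int (card (A \<inter> P)) + int (card (A \<inter> N))"
proof -
  have "(\<Sum>j\<in>A. (sign_vector (P, N) j)\<^sup>2) = (\<Sum>j\<in>A. of_bool (j \<in> P) + of_bool (j \<in> N))"
    using assms(2) by (intro sum.cong) (auto simp: sign_vector_def)
  then show ?thesis
    using assms(1) by (simp add: sum.distrib)
qed

section \<open>Each short vector gives a divisor of one sign\<close>

text \<open>For \<open>e_p - e_q\<close> the total is 0 and the partial sums are 1 between
  \<open>p\<close> and \<open>q\<close>, or -1 if \<open>q < p\<close>. For a triple
  \<open>P\<close> of positive entries, \<open>a 0 = -1\<close> and \<open>a i\<close> is the number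
  of elements of \<open>P\<close> below \<open>i\<close> minus \<open>min i 3\<close>, hence at most
  0; negative entries reverse the signs.\<close>

lemma signed_divisor_of:
  assumes "3 \<le> n" "(P, N) \<in> root_supports n"
  shows "(\<forall>i<n. 0 \<le> Poly_Mapping.lookup (divisor_of n (sign_vector (P, N))) i) \<or>
    (\<forall>i<n. Poly_Mapping.lookup (divisor_of n (sign_vector (P, N))) i \<le> 0)"
proof -
  have PN: "P \<subseteq> {..<n}" "N \<subseteq> {..<n}"
    using assms(2) by (auto simp: root_supports_iff)
  then have [simp]: "{..<n} \<inter> P = P" "{..<n} \<inter> N = N" and fin: "finite P" "finite N"
    using finite_subset by auto
  let ?c = "(int (card P) - int (card N)) div 3"
  have lk: "Poly_Mapping.lookup (divisor_of n (sign_vector (P, N))) i =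
      (if i = 0 then - ?c
       else int (card ({..<i} \<inter> P)) - int (card ({..<i} \<inter> N)) - ?c * int (min i 3))"
    if "i < n" for i
    using that by (simp add: lookup_divisor_of sum_sign_vector)
  have bound: "card ({..<i} \<inter> A) \<le> min i 3" if "finite A" "card A = 3" for i :: nat and A
    using card_mono[of A "{..<i} \<inter> A"] card_mono[of "{..<i}" "{..<i} \<inter> A"] that by simp
  consider p q where "P = {p}" "N = {q}" "p \<noteq> q" | "card P = 3" "N = {}" | "P = {}" "card N = 3"
    using assms(2) fin by (auto simp: root_supports_iff card_1_singleton_iff)
  then show ?thesis
  proof cases
    case 1
    have "card ({..<i} \<inter> {x}) = of_bool (x < i)" for i x :: nat
      by (auto simp: Int_insert_right)
    then show ?thesis
      by (cases p q rule: linorder_cases) (auto simp: lk[unfolded 1(1,2)] 1)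
  next
    case 2
    then have "Poly_Mapping.lookup (divisor_of n (sign_vector (P, N))) i \<le> 0" if "i < n" for i
      using that bound[OF fin(1), of i] lk[OF that] by simp
    then show ?thesis
      by blast
  next
    case 3
    then have "0 \<le> Poly_Mapping.lookup (divisor_of n (sign_vector (P, N))) i" if "i < n" for i
      using that bound[OF fin(2), of i] lk[OF that] by simp
    then show ?thesis
      by blast
  qed
qed

section \<open>Bijection with the triple root system\<close>

lemma coord_divisor_of_sign_vector:
  assumes "3 \<le> n" "(P, N) \<in> root_supports n" "j < n"
  shows "coord (Poly_Mapping.lookup (divisor_of n (sign_vector (P, N)))) j = sign_vector (P, N) j"
proof (rule coord_divisor_of[OF assms(1) _ assms(3)])
  have "{..<n} \<inter> P = P" "{..<n} \<inter> N = N"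
    using assms(2) by (auto simp: root_supports_iff)
  then show "3 dvd (\<Sum>j<n. sign_vector (P, N) j)"
    using assms(2) by (auto simp: sum_sign_vector root_supports_iff)
qed

lemma divisor_of_in_triple_root_system:
  assumes "4 \<le> n" "(P, N) \<in> root_supports n"
  shows "divisor_of n (sign_vector (P, N)) \<in> triple_root_system (H_graph n)"
proof -
  let ?Y = "divisor_of n (sign_vector (P, N))"
  have [simp]: "{..<n} \<inter> P = P" "{..<n} \<inter> N = N" and disj: "P \<inter> N = {}"
    using assms(2) by (auto simp: root_supports_iff)
  have mem: "?Y \<in> divisor_group (H_graph n)"
    using assms by (simp add: divisor_of_in_divisor_group)
  have "intersection_form (H_graph n) ?Y ?Y = - (\<Sum>j<n. (sign_vector (P, N) j)\<^sup>2)"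
    using assms by (simp add: intersection_form_H_graph mem coord_divisor_of_sign_vector)
  also have "\<dots> = - int (card P + card N)"
    using disj by (simp add: sum_sign_vector_squared)
  finally have form: "intersection_form (H_graph n) ?Y ?Y = -2 \<or>
      intersection_form (H_graph n) ?Y ?Y = -3"
    using assms(2) by (auto simp: root_supports_iff)
  \<comment> \<open>The form vanishes at the zero divisor.\<close>
  then have "?Y \<noteq> 0"
    by (auto simp: intersection_form_def)
  then show ?thesis
    using form mem signed_divisor_of[of n P N] assms
    by (auto simp: triple_root_system_def positive_divisor_def negative_divisor_def H_graph_def)
qed

lemma triple_root_system_in_image:
  assumes "4 \<le> n" "Y \<in> triple_root_system (H_graph n)"
  shows "Y \<in> (divisor_of n \<circ> sign_vector) ` root_supports n"
proof -
  let ?y = "coord (Poly_Mapping.lookup Y)"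
  have mem: "Y \<in> divisor_group (H_graph n)"
    using assms(2)
    by (auto simp: triple_root_system_def positive_divisor_def negative_divisor_def)
  have norm: "(\<Sum>j<n. (?y j)\<^sup>2) = 2 \<or> (\<Sum>j<n. (?y j)\<^sup>2) = 3"
    using assms mem by (auto simp: triple_root_system_def intersection_form_H_graph)
  have small: "?y j = -1 \<or> ?y j = 0 \<or> ?y j = 1" if "j < n" for j
  proof -
    \<comment> \<open>A single square is at most the norm, hence less than 4.\<close>
    have "(?y j)\<^sup>2 \<le> (\<Sum>j<n. (?y j)\<^sup>2)"
      using that by (intro member_le_sum) auto
    then have "\<bar>?y j\<bar>\<^sup>2 < 2\<^sup>2"
      using norm by auto
    then have "\<bar>?y j\<bar> < 2"
      by (rule power_less_imp_less_base) simp
    then show ?thesis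
      by auto
  qed
  define P where "P = {j. j < n \<and> ?y j = 1}"
  define N where "N = {j. j < n \<and> ?y j = -1}"
  have sub: "P \<subseteq> {..<n}" "N \<subseteq> {..<n}" and disj: "P \<inter> N = {}"
    by (auto simp: P_def N_def)
  then have [simp]: "{..<n} \<inter> P = P" "{..<n} \<inter> N = N"
    by auto
  have sv: "sign_vector (P, N) j = ?y j" if "j < n" for j
    using small[OF that] that by (auto simp: sign_vector_def P_def N_def)
  have "int (card P) + int (card N) = (\<Sum>j<n. (?y j)\<^sup>2)"
    using sum_sign_vector_squared[of "{..<n}" P N] disj sv by simp
  with norm have "card P + card N = 2 \<or> card P + card N = 3"
    by linarith
  moreover have "int (card P) - int (card N) = - 3 * Poly_Mapping.lookup Y 0"
    using sum_sign_vector[of "{..<n}" P N] sv sum_coord_divisor[OF _ mem] assms(1) by simp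
  \<comment> \<open>The difference of the cardinalities is divisible by 3, which excludes (2,0) and
    (0,2) for norm 2, and (2,1) and (1,2) for norm 3.\<close>
  ultimately have "card P = 1 \<and> card N = 1 \<or> card P = 3 \<and> card N = 0 \<or> card P = 0 \<and> card N = 3"
    by presburger
  with sub disj have "(P, N) \<in> root_supports n"
    by (simp add: root_supports_iff)
  moreover have "divisor_of n (sign_vector (P, N)) = Y"
    using assms(1) mem sv by (intro divisor_of_coord) auto
  ultimately show ?thesis
    by (metis comp_apply image_eqI)
qed

lemma inj_on_divisor_of_sign_vector:
  assumes "3 \<le> n"
  shows "inj_on (divisor_of n \<circ> sign_vector) (root_supports n)"
proof (rule inj_onI, clarsimp)
  fix P N P' N'
  assume mem: "(P, N) \<in> root_supports n" "(P', N') \<in> root_supports n"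
    and eq: "divisor_of n (sign_vector (P, N)) = divisor_of n (sign_vector (P', N'))"
  have "(j \<in> P \<longleftrightarrow> j \<in> P') \<and> (j \<in> N \<longleftrightarrow> j \<in> N')" for j
  proof (cases "j < n")
    case True
    then have "sign_vector (P, N) j = sign_vector (P', N') j"
      using coord_divisor_of_sign_vector[OF assms mem(1) True]
        coord_divisor_of_sign_vector[OF assms mem(2) True] eq by simp
    \<comment> \<open>Disjointness lets the sign vector determine both sets: an entry 0 then means
      membership in neither.\<close>
    moreover have "P \<inter> N = {}" "P' \<inter> N' = {}"
      using mem by (auto simp: root_supports_iff)
    ultimately show ?thesis
      by (auto simp: sign_vector_def of_bool_def split: if_splits)
  next
    case False
    then show ?thesis
      using mem by (auto simp: root_supports_iff)
  qed
  then show "P = P' \<and> N = N'"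
    by blast
qed

theorem proposition3p21:
  fixes n :: nat
  assumes "5 \<le> n"
  shows "finite (triple_root_system (H_graph n)) \<and>
    real (card (triple_root_system (H_graph n))) = (real n ^ 3 - real n) / 3"
proof -
  have "(divisor_of n \<circ> sign_vector) ` root_supports n = triple_root_system (H_graph n)"
    using divisor_of_in_triple_root_system[of n] triple_root_system_in_image[of n] assms
    by auto
  then have "bij_betw (divisor_of n \<circ> sign_vector) (root_supports n)
      (triple_root_system (H_graph n))"
    using inj_on_divisor_of_sign_vector[of n] assms by (auto simp: bij_betw_def)
  then show ?thesis
    using card_root_supports[of n] bij_betw_finite bij_betw_same_card by metis
qed

end
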